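(* Let $n,k$ be positive integers with $k<n$ such that $b := 2n/k$ is an integer, $k/2$ is an integer, and $b\leq k/2$. Then the mechanism $\mathrm{Select}_{k}$ (built from an arbitrary but fixed partition system $\mathcal{S}(n,k)$) is an impartial and $1/b$-optimal $(n,k)$-selection mechanism.
   Context: Write $[n]=\{1,\ldots,n\}$, and let $\mathcal{A}_n$ be the set of $n\times n$ real matrices with non-negative entries and zero diagonal; $A_{ij}$ is the weight of the vote agent $i$ casts for agent $j$. For $A\in\mathcal{A}_n$, $A_{-i}$ denotes $A$ with its $i$-th row removed. For $R,S\subseteq[n]$ let $\sigma_R(S;A)=\sum_{i\in R,\,j\in S}A_{ij}$, $\sigma(S;A)=\sigma_{[n]}(S;A)$, and write $j$ for $S=\{j\}$; the argument $A$ is omitted when clear. Let $\mathrm{OPT}_k(A)$ be an arbitrary set maximizing $\sigma(S;A)$ among $S\subseteq[n]$ with $|S|=k$. An $(n,k)$-selection mechanism is a function $f\colon\mathcal{A}_n\to 2^{[n]}$ with $|f(A)|\le k$ for all $A$. It is impartial if for all $A,A'\in\mathcal{A}_n$ and all $i\in[n]$ with $A_{-i}=A'_{-i}$ we have $f(A)\cap\{i\}=f(A')\cap\{i\}$. For $\alpha\in[0,1]$ it is $\alpha$-optimal if $\sigma(f(A);A)\ge\alpha\cdot\sigma(\mathrm{OPT}_k(A);A)$ for all $A\in\mathcal{A}_n$. Partition system: for $n,k$ as in the claim and $b=2n/k$, $\mathcal{S}(n,k)$ denotes an arbitrary but fixed sequence $((S_1^p,S_2^p))_{p\in[k]}$ with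 $[n]=S_1^p\,\dot\cup\,S_2^p$ (disjoint union) for each $p$, such that (i) $|S_2^p|=b$ for all $p\in[k]$; (ii) $|S_2^p\cap S_2^q|\le1$ for all $p\ne q$; (iii) $|\{p\in[k]: v\in S_2^p\}|=2$ for all $v\in[n]$; (iv) for every $U\subseteq[n]$ there is a partition of $U$ into $b$ (possibly empty) disjoint sets $U_1,\ldots,U_b$ such that for all $t\in[b]$, all distinct $u,v\in U_t$ and all $p\in[k]$, $u\in S_2^p$ implies $v\notin S_2^p$; and moreover $S_2^1=[b]$. (Such a sequence exists under the hypotheses on $n,k$.) Mechanism $\mathrm{Select}_k$ on input $A\in\mathcal{A}_n$: for each $j\in[n]$ let $\{l(j),r(j)\}=\{p\in[k]: j\in S_2^p\}$ with $l(j)<r(j)$, and define $\hat\sigma_{S_1^{l(j)}}(j)=\sigma_{S_1^{l(j)}}(j)$ and $\hat\sigma_{S_1^{r(j)}}(j)=\sigma_{S_1^{r(j)}\setminus S_1^{l(j)}}(j)$. For each $p\in[k]$ let $i^p\in S_2^p$ be the agent $j\in S_2^p$ maximizing the pair $(\hat\sigma_{S_1^p}(j),j)$ lexicographically (ties in modified score are broken in favor of the largest index). Output $\{i^p: p\in[k]\}$. *)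

theory Defs
  imports Complex_Main "HOL-Library.FuncSet" "HOL-Library.Disjoint_Sets"
    "HOL-Library.Product_Lexorder"
begin

text \<open>The set of agents is \<open>{1..n}\<close>. An \<open>n \<times> n\<close> matrix is a function of two indices that is zero
  outside \<open>{1..n} \<times> {1..n}\<close>, so that equality of functions is equality of matrices.\<close>

definition vote_matrices :: "nat \<Rightarrow> (nat \<Rightarrow> nat \<Rightarrow> real) set" where
  "vote_matrices n = {A.
     (\<forall>i\<in>{1..n}. \<forall>j\<in>{1..n}. 0 \<le> A i j) \<and>
     (\<forall>i\<in>{1..n}. A i i = 0) \<and>
     (\<forall>i j. i \<notin> {1..n} \<or> j \<notin> {1..n} \<longrightarrow> A i j = 0)}"

definition remove_row :: "nat \<Rightarrow> nat \<Rightarrow> (nat \<Rightarrow> nat \<Rightarrow> real) \<Rightarrow> (nat \<Rightarrow> nat \<Rightarrow> real)" where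
  "remove_row n i A = restrict A ({1..n} - {i})"

definition score :: "nat set \<Rightarrow> nat set \<Rightarrow> (nat \<Rightarrow> nat \<Rightarrow> real) \<Rightarrow> real" where
  "score R S A = (\<Sum>i\<in>R. \<Sum>j\<in>S. A i j)"

definition is_opt :: "nat \<Rightarrow> nat \<Rightarrow> (nat \<Rightarrow> nat \<Rightarrow> real) \<Rightarrow> nat set \<Rightarrow> bool" where
  "is_opt n k A T \<longleftrightarrow> T \<subseteq> {1..n} \<and> card T = k \<and>
     (\<forall>S. S \<subseteq> {1..n} \<and> card S = k \<longrightarrow> score {1..n} S A \<le> score {1..n} T A)"

definition selection_mechanism ::
    "nat \<Rightarrow> nat \<Rightarrow> ((nat \<Rightarrow> nat \<Rightarrow> real) \<Rightarrow> nat set) \<Rightarrow> bool" where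
  "selection_mechanism n k f \<longleftrightarrow>
     (\<forall>A\<in>vote_matrices n. f A \<subseteq> {1..n} \<and> card (f A) \<le> k)"

definition impartial :: "nat \<Rightarrow> ((nat \<Rightarrow> nat \<Rightarrow> real) \<Rightarrow> nat set) \<Rightarrow> bool" where
  "impartial n f \<longleftrightarrow>
     (\<forall>A\<in>vote_matrices n. \<forall>A'\<in>vote_matrices n. \<forall>i\<in>{1..n}.
        remove_row n i A = remove_row n i A' \<longrightarrow> f A \<inter> {i} = f A' \<inter> {i})"

definition optimal ::
    "nat \<Rightarrow> nat \<Rightarrow> real \<Rightarrow> ((nat \<Rightarrow> nat \<Rightarrow> real) \<Rightarrow> nat set) \<Rightarrow> bool" where
  "optimal n k \<alpha> f \<longleftrightarrow> 0 \<le> \<alpha> \<and> \<alpha> \<le> 1 \<and>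
     (\<forall>A\<in>vote_matrices n. \<forall>T. is_opt n k A T \<longrightarrow>
        \<alpha> * score {1..n} T A \<le> score {1..n} (f A) A)"

text \<open>A sequence of pairs \<open>(S1 p, S2 p)\<close>, where only the indices \<open>p \<in> {1..k}\<close> matter. The quotient
  \<open>2 * n div k\<close> is meant for \<open>k dvd 2 * n\<close>.\<close>

definition partition_system ::
    "nat \<Rightarrow> nat \<Rightarrow> (nat \<Rightarrow> nat set) \<Rightarrow> (nat \<Rightarrow> nat set) \<Rightarrow> bool" where
  "partition_system n k S1 S2 \<longleftrightarrow> (let b = 2 * n div k in
     (\<forall>p\<in>{1..k}. S1 p \<union> S2 p = {1..n} \<and> S1 p \<inter> S2 p = {}) \<and>
     (\<forall>p\<in>{1..k}. card (S2 p) = b) \<and>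
     (\<forall>p\<in>{1..k}. \<forall>q\<in>{1..k}. p \<noteq> q \<longrightarrow> card (S2 p \<inter> S2 q) \<le> 1) \<and>
     (\<forall>v\<in>{1..n}. card {p\<in>{1..k}. v \<in> S2 p} = 2) \<and>
     (\<forall>U. U \<subseteq> {1..n} \<longrightarrow>
        (\<exists>V :: nat \<Rightarrow> nat set.
           (\<Union>t\<in>{1..b}. V t) = U \<and> disjoint_family_on V {1..b} \<and>
           (\<forall>t\<in>{1..b}. \<forall>u\<in>V t. \<forall>v\<in>V t. u \<noteq> v \<longrightarrow>
              (\<forall>p\<in>{1..k}. u \<in> S2 p \<longrightarrow> v \<notin> S2 p)))) \<and>
     S2 1 = {1..b})"

text \<open>In a partition system \<open>{p \<in> {1..k}. j \<in> S2 p}\<close> has exactly two elements, which are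
  therefore its minimum and its maximum.\<close>

definition left_index :: "nat \<Rightarrow> (nat \<Rightarrow> nat set) \<Rightarrow> nat \<Rightarrow> nat" where
  "left_index k S2 j = Min {p\<in>{1..k}. j \<in> S2 p}"

definition right_index :: "nat \<Rightarrow> (nat \<Rightarrow> nat set) \<Rightarrow> nat \<Rightarrow> nat" where
  "right_index k S2 j = Max {p\<in>{1..k}. j \<in> S2 p}"

text \<open>The modified score of \<open>j\<close> in the \<open>p\<close>-th partition. It is only used for \<open>j \<in> S2 p\<close>, so the
  second case is \<open>p = right_index k S2 j\<close>.\<close>

definition mod_score ::
    "nat \<Rightarrow> (nat \<Rightarrow> nat set) \<Rightarrow> (nat \<Rightarrow> nat set) \<Rightarrow> (nat \<Rightarrow> nat \<Rightarrow> real) \<Rightarrow> nat \<Rightarrow> nat \<Rightarrow> real" where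
  "mod_score k S1 S2 A p j =
     (if p = left_index k S2 j then score (S1 (left_index k S2 j)) {j} A
      else score (S1 (right_index k S2 j) - S1 (left_index k S2 j)) {j} A)"

text \<open>Pairs in \<open>real \<times> nat\<close> are compared lexicographically.\<close>

definition winner ::
    "nat \<Rightarrow> (nat \<Rightarrow> nat set) \<Rightarrow> (nat \<Rightarrow> nat set) \<Rightarrow> (nat \<Rightarrow> nat \<Rightarrow> real) \<Rightarrow> nat \<Rightarrow> nat" where
  "winner k S1 S2 A p = arg_max_on (\<lambda>j. (mod_score k S1 S2 A p j, j)) (S2 p)"

definition Select ::
    "nat \<Rightarrow> (nat \<Rightarrow> nat set) \<Rightarrow> (nat \<Rightarrow> nat set) \<Rightarrow> (nat \<Rightarrow> nat \<Rightarrow> real) \<Rightarrow> nat set" where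
  "Select k S1 S2 A = winner k S1 S2 A ` {1..k}"

end

theory Submission
  imports Defs
begin

text \<open>The two sets \<open>S2 p\<close> containing an agent \<open>j\<close> meet only in \<open>j\<close>, so the two modified scores of
  \<open>j\<close> add up to its full score. For \<open>p\<close> with \<open>i \<in> S2 p\<close> no modified score in the \<open>p\<close>-th partition
  counts a vote of \<open>i\<close>, and \<open>i\<close> can be selected only in such partitions: this gives impartiality.
  For optimality, let \<open>M\<close> be the sum over \<open>p\<close> of the modified scores of the winners. Then \<open>M\<close> is at
  most the score of the selected set, while every set that meets each \<open>S2 p\<close> in at most one agent
  has score at most \<open>M\<close>; an optimal set is a union of \<open>b\<close> such sets.\<close>

section \<open>Maxima over finite sets and elementary facts on scores\<close>

lemma arg_max_on_if_finite:
  fixes f :: "'a \<Rightarrow> 'b :: linorder"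
  assumes "finite S" and "S \<noteq> {}"
  shows "arg_max_on f S \<in> S" and "\<And>x. x \<in> S \<Longrightarrow> f x \<le> f (arg_max_on f S)"
proof -
  \<comment> \<open>A point attaining the maximum of the image witnesses \<open>is_arg_max\<close>,
    so the choice operator behind \<open>arg_max_on\<close> returns some point with this
    property.\<close>
  have "Max (f ` S) \<in> f ` S"
    using assms by simp
  then obtain x where "x \<in> S" "f x = Max (f ` S)"
    by auto
  with assms(1) have "is_arg_max f (\<lambda>x. x \<in> S) x"
    by (auto simp: is_arg_max_linorder)
  then have "is_arg_max f (\<lambda>x. x \<in> S) (arg_max_on f S)"
    unfolding arg_max_on_def arg_max_def by (rule someI)
  then show "arg_max_on f S \<in> S" and "\<And>x. x \<in> S \<Longrightarrow> f x \<le> f (arg_max_on f S)"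
    by (auto simp: is_arg_max_linorder)
qed

lemma score_eq_sum_singleton: "score R S A = (\<Sum>j\<in>S. score R {j} A)"
  by (simp add: score_def sum.swap[of _ S])

lemma score_singleton_nonneg:
  assumes "A \<in> vote_matrices n" and "R \<subseteq> {1..n}"
  shows "0 \<le> score R {j} A"
proof -
  \<comment> \<open>The index \<open>j\<close> is arbitrary: outside \<open>{1..n}\<close> the entry
    is zero by the encoding of matrices.\<close>
  have "0 \<le> A i j" if "i \<in> R" for i
    using assms that by (cases "j \<in> {1..n}") (auto simp: vote_matrices_def)
  then show ?thesis
    by (simp add: score_def sum_nonneg)
qed

section \<open>Structure of a partition system\<close>

locale partitioned_agents =
  fixes n k b :: nat and S1 S2 :: "nat \<Rightarrow> nat set"
  assumes b_pos: "0 < b"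
    and b_eq: "b = 2 * n div k"
    and system: "partition_system n k S1 S2"
begin

lemma
  assumes "p \<in> {1..k}"
  shows S1_subset: "S1 p \<subseteq> {1..n}"
    and S2_subset: "S2 p \<subseteq> {1..n}"
    and S1_Un_S2: "S1 p \<union> S2 p = {1..n}"
    and S1_Int_S2: "S1 p \<inter> S2 p = {}"
    and card_S2: "card (S2 p) = b"
proof -
  have "S1 p \<union> S2 p = {1..n} \<and> S1 p \<inter> S2 p = {} \<and> card (S2 p) = b"
    using system assms by (simp add: partition_system_def Let_def b_eq)
  then show "S1 p \<subseteq> {1..n}" "S2 p \<subseteq> {1..n}" "S1 p \<union> S2 p = {1..n}" "S1 p \<inter> S2 p = {}"
      "card (S2 p) = b"
    by blast+
qed

lemma finite_S2: "p \<in> {1..k} \<Longrightarrow> finite (S2 p)"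
  by (meson S2_subset finite_atLeastAtMost finite_subset)

lemma S2_nonempty: "p \<in> {1..k} \<Longrightarrow> S2 p \<noteq> {}"
  using card_S2 b_pos by fastforce

text \<open>Every agent lies in exactly two sets \<open>S2 p\<close>, so the minimum and maximum
  that define its left and right index are just the smaller and the larger of the two.\<close>

lemma two_partitions:
  assumes "v \<in> {1..n}"
  obtains l r where "l < r" and "{p \<in> {1..k}. v \<in> S2 p} = {l, r}"
    and "left_index k S2 v = l" and "right_index k S2 v = r"
proof -
  have "card {p \<in> {1..k}. v \<in> S2 p} = 2"
    using system assms by (simp add: partition_system_def Let_def)
  then obtain x y where "{p \<in> {1..k}. v \<in> S2 p} = {x, y}" "x \<noteq> y"
    by (meson card_2_iff)
  then obtain l r where lr: "l < r" and P: "{p \<in> {1..k}. v \<in> S2 p} = {l, r}"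
    by (metis insert_commute nat_neq_iff)
  moreover have "left_index k S2 v = l" "right_index k S2 v = r"
    using lr unfolding left_index_def right_index_def P by auto
  ultimately show thesis
    by (rule that)
qed

lemma S2_Int_eq_singleton:
  assumes "p \<in> {1..k}" and "q \<in> {1..k}" and "p \<noteq> q" and "v \<in> S2 p" and "v \<in> S2 q"
  shows "S2 p \<inter> S2 q = {v}"
proof -
  have "card (S2 p \<inter> S2 q) \<le> 1"
    using system assms by (simp add: partition_system_def Let_def)
  moreover have "finite (S2 p \<inter> S2 q)"
    using finite_S2 assms by blast
  ultimately show ?thesis
    using assms(4,5) card_le_Suc0_iff_eq by fastforce
qed

section \<open>Modified scores\<close>

lemma sum_mod_score:
  assumes A: "A \<in> vote_matrices n" and v: "v \<in> {1..n}"
  shows "(\<Sum>p | p \<in> {1..k} \<and> v \<in> S2 p. mod_score k S1 S2 A p v) = score {1..n} {v} A"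
proof -
  obtain l r where lr: "l < r" and P: "{p \<in> {1..k}. v \<in> S2 p} = {l, r}"
    and idx: "left_index k S2 v = l" "right_index k S2 v = r"
    using v by (rule two_partitions)
  then have lrk: "l \<in> {1..k}" "r \<in> {1..k}" and lrS: "v \<in> S2 l" "v \<in> S2 r"
    by blast+
  have "S2 l \<inter> S2 r = {v}"
    using S2_Int_eq_singleton lrk lr lrS by simp
  \<comment> \<open>The complement of \<open>S1 l \<union> S1 r\<close> is
    \<open>S2 l \<inter> S2 r = {v}\<close>. Subtracting \<open>S1 l\<close> in the second set keeps
    a voter in both from being counted twice.\<close>
  then have cover: "insert v (S1 l \<union> (S1 r - S1 l)) = {1..n}"
    using S1_Un_S2[OF lrk(1)] S1_Un_S2[OF lrk(2)] by blast
  have notin: "v \<notin> S1 l \<union> (S1 r - S1 l)"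
    using S1_Int_S2 lrk lrS by blast
  have fin: "finite (S1 l)" "finite (S1 r)"
    using S1_subset lrk by (meson finite_atLeastAtMost finite_subset)+
  have "(\<Sum>p\<in>{l, r}. mod_score k S1 S2 A p v)
      = (\<Sum>i\<in>S1 l. A i v) + (\<Sum>i\<in>S1 r - S1 l. A i v)"
    using lr by (simp add: mod_score_def idx score_def)
  also have "\<dots> = (\<Sum>i\<in>S1 l \<union> (S1 r - S1 l). A i v)"
    using fin by (intro sum.union_disjoint[symmetric]) auto
  \<comment> \<open>Adding voter \<open>v\<close> changes nothing, as the diagonal of
    \<open>A\<close> is zero.\<close>
  also have "\<dots> = (\<Sum>i\<in>insert v (S1 l \<union> (S1 r - S1 l)). A i v)"
    using notin fin A v by (subst sum.insert) (auto simp: vote_matrices_def)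
  finally show ?thesis
    unfolding P using cover by (simp add: score_def)
qed

lemma mod_score_nonneg:
  assumes "A \<in> vote_matrices n" and "p \<in> {1..k}" and "v \<in> S2 p"
  shows "0 \<le> mod_score k S1 S2 A p v"
proof -
  have "v \<in> {1..n}"
    using S2_subset assms by blast
  then obtain l r where lr: "l < r" and P: "{p \<in> {1..k}. v \<in> S2 p} = {l, r}"
    and idx: "left_index k S2 v = l" "right_index k S2 v = r"
    by (rule two_partitions)
  from P have "l \<in> {1..k}" "r \<in> {1..k}"
    by blast+
  then have "S1 l \<subseteq> {1..n}" "S1 r - S1 l \<subseteq> {1..n}"
    using S1_subset by blast+
  then show ?thesis
    using score_singleton_nonneg[OF assms(1)]
    by (simp add: mod_score_def idx)
qed

section \<open>Winners and impartiality\<close>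

lemma winner_in_S2: "p \<in> {1..k} \<Longrightarrow> winner k S1 S2 A p \<in> S2 p"
  unfolding winner_def by (rule arg_max_on_if_finite(1)[OF finite_S2 S2_nonempty])

text \<open>A lexicographic maximum also maximizes the first component, so tie-breaking by index
  does not affect this bound.\<close>

lemma mod_score_le_winner:
  assumes "p \<in> {1..k}" and "v \<in> S2 p"
  shows "mod_score k S1 S2 A p v \<le> mod_score k S1 S2 A p (winner k S1 S2 A p)"
  using arg_max_on_if_finite(2)[OF finite_S2 S2_nonempty, OF assms(1) assms(1) assms(2),
      of "\<lambda>j. (mod_score k S1 S2 A p j, j)"]
  unfolding winner_def by (auto simp: less_eq_prod_def)

lemma winner_cong:
  assumes "p \<in> {1..k}" and "i \<in> S2 p" and rows: "remove_row n i A = remove_row n i A'"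
  shows "winner k S1 S2 A p = winner k S1 S2 A' p"
proof -
  have row: "A x = A' x" if "x \<in> {1..n} - {i}" for x
    using fun_cong[OF rows, of x] that by (simp add: remove_row_def)
  have mod: "mod_score k S1 S2 A p j = mod_score k S1 S2 A' p j" if "j \<in> S2 p" for j
  proof -
    have "j \<in> {1..n}"
      using S2_subset assms that by blast
    then obtain l r where lr: "l < r" and P: "{p \<in> {1..k}. j \<in> S2 p} = {l, r}"
      and idx: "left_index k S2 j = l" "right_index k S2 j = r"
      by (rule two_partitions)
    \<comment> \<open>Since \<open>i \<in> S2 p\<close>, row \<open>i\<close> is not among the rows
      in \<open>S1 p\<close>. Whether \<open>p\<close> is the left or the right index of
      \<open>j\<close>, the modified score sums over a subset of \<open>S1 p\<close>.\<close>
    have A: "A x = A' x" if "x \<in> S1 p" for x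
      using that S1_subset S1_Int_S2 assms(1,2) by (intro row) blast
    have "p = l \<or> p = r"
      using P that assms(1) by blast
    then show ?thesis
    proof
      assume "p = l"
      then show ?thesis
        using A by (simp add: mod_score_def idx score_def)
    next
      assume "p = r"
      then show ?thesis
        using A lr by (simp add: mod_score_def idx score_def)
    qed
  qed
  show ?thesis
    \<comment> \<open>Both winners are choices from a predicate that evaluates the keys only on
      \<open>S2 p\<close>. There the keys agree, so the predicates, and hence the chosen agents, are
      equal.\<close>
    unfolding winner_def arg_max_on_def arg_max_def is_arg_max_def
    by (rule arg_cong[where f = Eps]) (auto simp: mod fun_eq_iff)
qed

lemma Select_subset: "Select k S1 S2 A \<subseteq> {1..n}"
proof
  fix v assume "v \<in> Select k S1 S2 A"
  then obtain p where "p \<in> {1..k}" and "v = winner k S1 S2 A p"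
    unfolding Select_def by blast
  then show "v \<in> {1..n}"
    using winner_in_S2 S2_subset by blast
qed

lemma selection_mechanism_Select: "selection_mechanism n k (Select k S1 S2)"
proof -
  have "card (Select k S1 S2 A) \<le> k" for A
    using card_image_le[of "{1..k}" "winner k S1 S2 A"] by (simp add: Select_def)
  then show ?thesis
    unfolding selection_mechanism_def using Select_subset by blast
qed

lemma in_Select_transfer:
  assumes "i \<in> Select k S1 S2 A" and rows: "remove_row n i A = remove_row n i A'"
  shows "i \<in> Select k S1 S2 A'"
proof -
  from assms(1) obtain p where p: "p \<in> {1..k}" and i: "i = winner k S1 S2 A p"
    by (auto simp: Select_def)
  have "i \<in> S2 p"
    using winner_in_S2[OF p] i by simp
  with rows have "i = winner k S1 S2 A' p"
    using winner_cong[OF p] i by metis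
  with p show ?thesis
    unfolding Select_def by blast
qed

lemma impartial_Select: "impartial n (Select k S1 S2)"
  unfolding impartial_def
proof (intro ballI impI)
  fix A A' i
  assume "remove_row n i A = remove_row n i A'"
  then have "i \<in> Select k S1 S2 A \<longleftrightarrow> i \<in> Select k S1 S2 A'"
    using in_Select_transfer by metis
  then show "Select k S1 S2 A \<inter> {i} = Select k S1 S2 A' \<inter> {i}"
    by blast
qed

section \<open>Approximation guarantee\<close>

lemma sum_winner_le_score_Select:
  assumes A: "A \<in> vote_matrices n"
  shows "(\<Sum>p\<in>{1..k}. mod_score k S1 S2 A p (winner k S1 S2 A p))
    \<le> score {1..n} (Select k S1 S2 A) A"
proof -
  let ?w = "winner k S1 S2 A" and ?m = "mod_score k S1 S2 A"
  \<comment> \<open>The partitions are grouped by their winner, because one agent may win twice but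
    is counted once in the selected set.\<close>
  have "(\<Sum>p\<in>{1..k}. ?m p (?w p))
      = (\<Sum>v\<in>Select k S1 S2 A. \<Sum>p | p \<in> {1..k} \<and> ?w p = v. ?m p (?w p))"
    by (rule sum.group[symmetric]) (auto simp: Select_def)
  also have "\<dots> \<le> (\<Sum>v\<in>Select k S1 S2 A. score {1..n} {v} A)"
  proof (rule sum_mono)
    fix v assume v: "v \<in> Select k S1 S2 A"
    have "(\<Sum>p | p \<in> {1..k} \<and> ?w p = v. ?m p (?w p)) = (\<Sum>p | p \<in> {1..k} \<and> ?w p = v. ?m p v)"
      by (rule sum.cong) auto
    \<comment> \<open>An agent wins only in partitions with \<open>v \<in> S2 p\<close>; those it
      does not win contribute nonnegative terms.\<close>
    also have "\<dots> \<le> (\<Sum>p | p \<in> {1..k} \<and> v \<in> S2 p. ?m p v)"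
      using winner_in_S2 mod_score_nonneg[OF A] by (intro sum_mono2) auto
    also have "\<dots> = score {1..n} {v} A"
      using v Select_subset sum_mod_score[OF A] by blast
    finally show "(\<Sum>p | p \<in> {1..k} \<and> ?w p = v. ?m p (?w p)) \<le> score {1..n} {v} A" .
  qed
  finally show ?thesis
    by (simp flip: score_eq_sum_singleton)
qed

text \<open>Double counting: each score is split into its two modified scores, and the sum is
  regrouped by partition. Each partition then holds at most one term, which its winner
  dominates.\<close>

lemma score_transversal_le:
  assumes A: "A \<in> vote_matrices n" and U: "U \<subseteq> {1..n}"
    and trans: "\<forall>p\<in>{1..k}. \<forall>u\<in>U \<inter> S2 p. \<forall>v\<in>U \<inter> S2 p. u = v"
  shows "score {1..n} U A \<le> (\<Sum>p\<in>{1..k}. mod_score k S1 S2 A p (winner k S1 S2 A p))"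
proof -
  let ?w = "winner k S1 S2 A" and ?m = "mod_score k S1 S2 A"
  have "finite U"
    using U finite_subset by blast
  have "score {1..n} U A = (\<Sum>v\<in>U. score {1..n} {v} A)"
    by (rule score_eq_sum_singleton)
  also have "\<dots> = (\<Sum>v\<in>U. \<Sum>p | p \<in> {1..k} \<and> v \<in> S2 p. ?m p v)"
    by (rule sum.cong) (use U sum_mod_score[OF A] in auto)
  also have "\<dots> = (\<Sum>p\<in>{1..k}. \<Sum>v | v \<in> U \<and> v \<in> S2 p. ?m p v)"
    by (rule sum.swap_restrict) (use \<open>finite U\<close> in auto)
  also have "\<dots> \<le> (\<Sum>p\<in>{1..k}. ?m p (?w p))"
  proof (rule sum_mono)
    fix p assume p: "p \<in> {1..k}"
    show "(\<Sum>v | v \<in> U \<and> v \<in> S2 p. ?m p v) \<le> ?m p (?w p)"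
    \<comment> \<open>If \<open>U\<close> misses \<open>S2 p\<close>, the left side is zero and the
      bound rests on the nonnegativity of the winner's modified score.\<close>
    proof (cases "U \<inter> S2 p = {}")
      case True
      then have "{v. v \<in> U \<and> v \<in> S2 p} = {}"
        by blast
      then show ?thesis
        by (metis sum.empty mod_score_nonneg[OF A p winner_in_S2[OF p]])
    next
      case False
      then obtain v where "v \<in> U \<inter> S2 p"
        by blast
      then have "v \<in> S2 p" and "{v. v \<in> U \<and> v \<in> S2 p} = {v}"
        using trans p by blast+
      then show ?thesis
        using mod_score_le_winner[OF p] by simp
    qed
  qed
  finally show ?thesis .
qed

text \<open>Condition (iv) of the partition system, recast from pairs of distinct agents into the
  form "at most one agent per \<open>S2 p\<close>" that the transversal bound takes.\<close>

lemma transversal_partition: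
  assumes "U \<subseteq> {1..n}"
  obtains V :: "nat \<Rightarrow> nat set"
  where "(\<Union>t\<in>{1..b}. V t) = U" and "disjoint_family_on V {1..b}"
    and "\<forall>t\<in>{1..b}. \<forall>p\<in>{1..k}. \<forall>u\<in>V t \<inter> S2 p. \<forall>v\<in>V t \<inter> S2 p. u = v"
proof -
  have "\<exists>V :: nat \<Rightarrow> nat set. (\<Union>t\<in>{1..b}. V t) = U \<and> disjoint_family_on V {1..b} \<and>
      (\<forall>t\<in>{1..b}. \<forall>u\<in>V t. \<forall>v\<in>V t. u \<noteq> v \<longrightarrow> (\<forall>p\<in>{1..k}. u \<in> S2 p \<longrightarrow> v \<notin> S2 p))"
    using system assms by (simp add: partition_system_def Let_def b_eq)
  then show thesis
    using that by blast
qed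

lemma score_le_score_Select:
  assumes A: "A \<in> vote_matrices n" and T: "T \<subseteq> {1..n}"
  shows "score {1..n} T A \<le> real b * score {1..n} (Select k S1 S2 A) A"
proof -
  obtain V :: "nat \<Rightarrow> nat set" where V: "(\<Union>t\<in>{1..b}. V t) = T" "disjoint_family_on V {1..b}"
    and trans: "\<forall>t\<in>{1..b}. \<forall>p\<in>{1..k}. \<forall>u\<in>V t \<inter> S2 p. \<forall>v\<in>V t \<inter> S2 p. u = v"
    using T by (rule transversal_partition)
  have VT: "V t \<subseteq> {1..n}" if "t \<in> {1..b}" for t
    using V(1) T that by blast
  then have "finite (V t)" if "t \<in> {1..b}" for t
    using that finite_subset by blast
  then have "score {1..n} T A = (\<Sum>t\<in>{1..b}. \<Sum>v\<in>V t. score {1..n} {v} A)"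
    using V(2) unfolding V(1)[symmetric] score_eq_sum_singleton[of _ "\<Union>t\<in>{1..b}. V t"]
    by (intro sum.UNION_disjoint) (auto simp: disjoint_family_on_def)
  also have "\<dots> = (\<Sum>t\<in>{1..b}. score {1..n} (V t) A)"
    by (simp flip: score_eq_sum_singleton)
  \<comment> \<open>Each of the \<open>b\<close> classes is bounded separately by the whole selected
    score; this is the source of the factor \<open>b\<close>.\<close>
  also have "\<dots> \<le> (\<Sum>t\<in>{1..b}. score {1..n} (Select k S1 S2 A) A)"
  proof (rule sum_mono)
    fix t assume t: "t \<in> {1..b}"
    show "score {1..n} (V t) A \<le> score {1..n} (Select k S1 S2 A) A"
      using score_transversal_le[OF A VT[OF t] bspec[OF trans t]] sum_winner_le_score_Select[OF A]
      by (rule order_trans)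
  qed
  finally show ?thesis
    by simp
qed

lemma optimal_Select: "optimal n k (1 / real b) (Select k S1 S2)"
  unfolding optimal_def
proof (intro conjI ballI allI impI)
  show "0 \<le> 1 / real b" "1 / real b \<le> 1"
    using b_pos by simp_all
next
  fix A T assume "A \<in> vote_matrices n" and "is_opt n k A T"
  then have "score {1..n} T A \<le> real b * score {1..n} (Select k S1 S2 A) A"
    by (intro score_le_score_Select) (simp_all add: is_opt_def)
  then show "1 / real b * score {1..n} T A \<le> score {1..n} (Select k S1 S2 A) A"
    using b_pos by (simp add: divide_le_eq mult.commute)
qed

end

theorem lemma4p2:
  fixes n k b :: nat and S1 S2 :: "nat \<Rightarrow> nat set"
  assumes "0 < n" and "0 < k" and "k < n"
    and "k dvd 2 * n" and "b = 2 * n div k"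
    and "even k" and "b \<le> k div 2"
    and "partition_system n k S1 S2"
  shows "selection_mechanism n k (Select k S1 S2) \<and>
         impartial n (Select k S1 S2) \<and>
         optimal n k (1 / real b) (Select k S1 S2)"
proof -
  \<comment> \<open>The integer quotient is positive because \<open>k < n\<close> gives
    \<open>k \<le> 2 * n\<close>.\<close>
  have "0 < b"
    using assms by (simp add: div_greater_zero_iff)
  then interpret partitioned_agents n k b S1 S2
    using assms by unfold_locales
  show ?thesis
    using selection_mechanism_Select impartial_Select optimal_Select by blast
qed

end
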